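(* The fractional chromatic number of the plane is at least $\frac{76}{21}$, i.e., $\chi_f(\mathbb{R}^2)\ge \frac{76}{21}$.
   Context: The unit distance graph of the plane is the (uncountably infinite) graph whose vertices are the points of $\mathbb{R}^2$, with an edge between two points exactly when their Euclidean distance is $1$. For a graph $G$, a fractional coloring assigns to each independent set of $G$ a nonnegative weight (with only countably many independent sets receiving positive weight) such that, for every vertex $v$, the weights of the independent sets containing $v$ sum to at least $1$; the fractional chromatic number $\chi_f(G)$ is the infimum of the total weight over all fractional colorings of $G$. In particular $\chi_f(G)\ge\chi_f(H)$ for every finite subgraph $H$ of $G$. $\chi_f(\mathbb{R}^2)$ denotes the fractional chromatic number of the unit distance graph of the plane. *)

theory Defs
  imports "HOL-Analysis.Analysis"
begin

text \<open>A graph, finite or infinite, is given by its vertex set and its (symmetric, irreflexive)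
  adjacency relation.\<close>

definition independent_set :: "'a set \<Rightarrow> ('a \<Rightarrow> 'a \<Rightarrow> bool) \<Rightarrow> 'a set \<Rightarrow> bool" where
  "independent_set V adj S \<longleftrightarrow> S \<subseteq> V \<and> (\<forall>x\<in>S. \<forall>y\<in>S. \<not> adj x y)"

text \<open>Weights are real, but they are summed in \<^typ>\<open>ennreal\<close>: there every family is summable, so a
  divergent sum is \<^term>\<open>\<infinity> :: ennreal\<close> and not the default value that \<^const>\<open>infsum\<close> takes on
  the reals.\<close>

definition fractional_coloring :: "'a set \<Rightarrow> ('a \<Rightarrow> 'a \<Rightarrow> bool) \<Rightarrow> ('a set \<Rightarrow> real) \<Rightarrow> bool" where
  "fractional_coloring V adj w \<longleftrightarrow>
     (\<forall>S. 0 \<le> w S) \<and>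
     (\<forall>S. 0 < w S \<longrightarrow> independent_set V adj S) \<and>
     countable {S. 0 < w S} \<and>
     (\<forall>v\<in>V. 1 \<le> (\<Sum>\<^sub>\<infinity>S\<in>{S. independent_set V adj S \<and> v \<in> S}. ennreal (w S)))"

definition total_weight :: "'a set \<Rightarrow> ('a \<Rightarrow> 'a \<Rightarrow> bool) \<Rightarrow> ('a set \<Rightarrow> real) \<Rightarrow> ennreal" where
  "total_weight V adj w = (\<Sum>\<^sub>\<infinity>S\<in>{S. independent_set V adj S}. ennreal (w S))"

definition fractional_chromatic_number :: "'a set \<Rightarrow> ('a \<Rightarrow> 'a \<Rightarrow> bool) \<Rightarrow> ennreal" where
  "fractional_chromatic_number V adj =
     (INF w\<in>{w. fractional_coloring V adj w}. total_weight V adj w)"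

definition unit_distance :: "real ^ 2 \<Rightarrow> real ^ 2 \<Rightarrow> bool" where
  "unit_distance x y \<longleftrightarrow> dist x y = 1"

lemma symp_unit_distance: "symp unit_distance"
  by (auto simp: symp_def unit_distance_def dist_commute)

lemma irreflp_unit_distance: "irreflp unit_distance"
  by (auto simp: irreflp_def unit_distance_def)

end

theory Submission
  imports Defs
begin

text \<open>The bound proved here is 11/3. Let \<open>R\<close> be the unit rhombus with corners 0, 1, \<open>\<omega>\<close>, \<open>1 + \<omega>\<close>, where
  \<open>\<omega>\<close> is a primitive sixth root of unity, and let \<open>\<theta>\<close> be the rotation of the Moser spindle. On the
  16 points of \<open>R + \<theta> R\<close> there is a quadratic polynomial in the indicator \<open>f\<close> of a set that is at most 3
  whenever the set is independent. Its linear coefficients sum to 11, and its mixed terms \<open>f(P) f(Q)\<close>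
  cancel within each class of difference vectors \<open>Q - P\<close> modulo rotation by \<open>\<omega>\<close>.

  Sum this inequality over the independent sets of a fractional coloring of total weight \<open>T\<close> and
  average over the translates and the six rotations of the window. The plane is amenable under
  translations, so the mixed terms cancel and every point contributes its covering weight, which is
  at least 1. This leaves \<open>11 \<le> 3 T\<close>.\<close>

section \<open>Functions of mean zero\<close>

text \<open>Functions that vanish in the mean under every translation-invariant mean. Working with them
  replaces the choice of an invariant mean on the bounded functions.\<close>

inductive coboundary :: "('a::real_vector \<Rightarrow> real) \<Rightarrow> bool" where
  zero: "coboundary (\<lambda>_. 0)"
| step: "coboundary h \<Longrightarrow> (\<And>x. \<bar>g x\<bar> \<le> B) \<Longrightarrow> coboundary (\<lambda>x. h x + (g (x + e) - g x))"

lemma coboundary_diff: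
  assumes "\<And>x. \<bar>g x\<bar> \<le> B"
  shows "coboundary (\<lambda>x. g (x + e) - g x)"
  using coboundary.step[OF coboundary.zero assms] by simp

lemma coboundary_add:
  assumes "coboundary h" "coboundary h'"
  shows "coboundary (\<lambda>x. h x + h' x)"
  using assms(2)
proof induction
  case zero
  then show ?case using assms(1) by simp
next
  case (step h' g B e)
  show ?case
    using coboundary.step[OF step.IH step.hyps(2), where e = e] by (simp add: add.assoc)
qed

lemma coboundary_cmult:
  assumes "coboundary h"
  shows "coboundary (\<lambda>x. c * h x)"
  using assms
proof induction
  case zero
  then show ?case using coboundary.zero by simp
next
  case (step h g B e)
  have "\<bar>c * g x\<bar> \<le> \<bar>c\<bar> * B" for x
    using step.hyps(2) by (simp add: abs_mult mult_left_mono)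
  from coboundary.step[OF step.IH this, where e = e] show ?case by (simp add: algebra_simps)
qed

lemma coboundary_sum:
  assumes "finite A" "\<And>i. i \<in> A \<Longrightarrow> coboundary (h i)"
  shows "coboundary (\<lambda>x. \<Sum>i\<in>A. h i x)"
  using assms by (induction A) (auto intro: coboundary.zero coboundary_add)

lemma coboundary_sum_list:
  assumes "\<And>i. i \<in> set xs \<Longrightarrow> coboundary (h i)"
  shows "coboundary (\<lambda>x. \<Sum>i\<leftarrow>xs. h i x)"
  using assms by (induction xs) (auto intro: coboundary.zero coboundary_add)

lemma sum_list_map_concat:
  "(\<Sum>x\<leftarrow>concat xss. f x :: real) = (\<Sum>xs\<leftarrow>xss. \<Sum>x\<leftarrow>xs. f x)"
  by (induction xss) auto

text \<open>An elementary form of amenability: along a progression with step \<open>e\<close> the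
  differences of \<open>g\<close> telescope, and what remains is at most \<open>2 * B\<close>
  however long the progression is.\<close>

lemma coboundary_average_le:
  fixes \<delta> :: real
  assumes "coboundary h" "\<delta> > 0"
  shows "\<exists>es. es \<noteq> [] \<and> (\<forall>x. (\<Sum>d\<leftarrow>es. h (x + d)) \<le> \<delta> * length es)"
  using assms
proof (induction arbitrary: \<delta>)
  case zero
  then show ?case by (intro exI[of _ "[0]"]) auto
next
  case (step h g B e)
  obtain es where es: "es \<noteq> []" "\<And>x. (\<Sum>d\<leftarrow>es. h (x + d)) \<le> \<delta> / 2 * length es"
    using step.IH[of "\<delta> / 2"] step.prems by auto
  obtain M :: nat where M: "M > 0" "2 * B \<le> \<delta> / 2 * M"
  proof -
    obtain M0 :: nat where "4 * B / \<delta> \<le> M0" using real_arch_simple by blast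
    then have "2 * B \<le> \<delta> / 2 * Suc M0" using step.prems by (simp add: field_simps)
    then show ?thesis using that by blast
  qed
  \<comment> \<open>Each \<open>d\<close> becomes a progression of length \<open>M\<close>. The
    bound for \<open>h\<close> is uniform in \<open>x\<close>, so it survives the shifts, and
    \<open>M\<close> makes the boundary term of \<open>g\<close> at most the other half of the
    budget.\<close>
  define es' where "es' = concat (map (\<lambda>d. map (\<lambda>i. d + real i *\<^sub>R e) [0..<M]) es)"
  have len: "length es' = M * length es"
    by (simp add: es'_def length_concat comp_def sum_list_triv)
  have "(\<Sum>d\<leftarrow>es'. h (x + d) + (g (x + d + e) - g (x + d))) \<le> \<delta> * length es'" for x
  proof -
    have split: "(\<Sum>d\<leftarrow>es'. F d) = (\<Sum>d\<leftarrow>es. \<Sum>i<M. F (d + real i *\<^sub>R e))" for F :: "'a \<Rightarrow> real"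
      by (simp add: es'_def sum_list_map_concat comp_def interv_sum_list_conv_sum_set_nat
        atLeast0LessThan)
    have "(\<Sum>d\<leftarrow>es'. h (x + d)) = (\<Sum>i<M. \<Sum>d\<leftarrow>es. h ((x + real i *\<^sub>R e) + d))"
      unfolding split by (induction es) (simp_all add: sum.distrib algebra_simps)
    also have "\<dots> \<le> (\<Sum>i<M. \<delta> / 2 * length es)"
      by (intro sum_mono es(2))
    finally have 1: "(\<Sum>d\<leftarrow>es'. h (x + d)) \<le> \<delta> / 2 * M * length es"
      by (simp add: mult_ac)
    have tel: "(\<Sum>i<M. g (x + (d + real i *\<^sub>R e) + e) - g (x + (d + real i *\<^sub>R e)))
        = g (x + d + real M *\<^sub>R e) - g (x + d)" for d
      using sum_lessThan_telescope[of "\<lambda>i. g (x + d + real i *\<^sub>R e)" M]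
      by (simp add: algebra_simps)
    have "(\<Sum>d\<leftarrow>es'. g (x + d + e) - g (x + d)) = (\<Sum>d\<leftarrow>es. g (x + d + real M *\<^sub>R e) - g (x + d))"
      unfolding split tel ..
    also have "\<dots> \<le> (\<Sum>d\<leftarrow>es. \<delta> / 2 * M)"
    proof (rule sum_list_mono)
      fix d
      show "g (x + d + real M *\<^sub>R e) - g (x + d) \<le> \<delta> / 2 * M"
        using step.hyps(2)[of "x + d + real M *\<^sub>R e"] step.hyps(2)[of "x + d"] M(2) by linarith
    qed
    finally have 2: "(\<Sum>d\<leftarrow>es'. g (x + d + e) - g (x + d)) \<le> \<delta> / 2 * M * length es"
      by (simp add: sum_list_triv mult_ac)
    show ?thesis
      using 1 2 by (simp add: sum_list_addf len)
  qed
  moreover have "es' \<noteq> []" using len es(1) M(1) by auto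
  ultimately show ?case by (intro exI[of _ es']) auto
qed

text \<open>If \<open>\<delta>\<close> were positive, some average of \<open>h\<close> would be at
  most \<open>\<delta> / 2\<close>, below its pointwise bound.\<close>

lemma coboundary_lower_bound:
  fixes \<delta> :: real
  assumes "coboundary h" "\<And>x. \<delta> \<le> h x"
  shows "\<delta> \<le> 0"
proof (rule ccontr)
  assume "\<not> \<delta> \<le> 0"
  then have "\<delta> / 2 > 0" by simp
  then obtain es where es: "es \<noteq> []" "(\<Sum>d\<leftarrow>es. h (0 + d)) \<le> \<delta> / 2 * length es"
    using coboundary_average_le[OF assms(1)] by blast
  have "\<delta> * length es = (\<Sum>d\<leftarrow>es. \<delta>)" by (simp add: sum_list_triv)
  also have "\<dots> \<le> (\<Sum>d\<leftarrow>es. h (0 + d))" by (intro sum_list_mono assms(2))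
  finally have "\<delta> * length es \<le> \<delta> / 2 * length es" using es(2) by linarith
  then show False using es(1) \<open>\<not> \<delta> \<le> 0\<close> by simp
qed

section \<open>The local inequality\<close>

text \<open>The corners 0, 1, \<open>\<omega>\<close>, \<open>1 + \<omega>\<close> of the rhombus; all pairs but the first and last are at distance 1.\<close>

datatype corner = C0 | C1 | Cw | Ct

definition corner_adj :: "corner \<Rightarrow> corner \<Rightarrow> bool" where
  "corner_adj r s \<longleftrightarrow> r \<noteq> s \<and> {r, s} \<noteq> {C0, Ct}"

text \<open>An optimal solution of a linear program. An entry \<open>(c, P, Q)\<close> stands for \<open>c\<close> times the indicator
  that \<open>P\<close> and \<open>Q\<close> are both in the independent set; \<open>(r, s)\<close> stands for the point \<open>r + \<theta> s\<close>.
  The coefficients with \<open>P = Q\<close> add up to 11. The others add up to 0 over each class of differences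
  \<open>Q - P\<close> modulo multiplication by powers of \<open>\<omega>\<close>; each of the last seven lines is one
  such class.\<close>

definition window :: "(real \<times> (corner \<times> corner) \<times> (corner \<times> corner)) list" where
  "window =
    [(1, (C0, C0), (C0, C0)), (1, (C0, C1), (C0, C1)), (1, (C0, Cw), (C0, Cw)),
     (1, (C0, Ct), (C0, Ct)), (1, (C1, C0), (C1, C0)), (-1, (C1, C1), (C1, C1)),
     (2, (C1, Cw), (C1, Cw)), (1, (C1, Ct), (C1, Ct)), (1, (Cw, Cw), (Cw, Cw)),
     (1, (Ct, C0), (Ct, C0)), (1, (Ct, C1), (Ct, C1)), (1, (Ct, Cw), (Ct, Cw)),
     (-1, (C0, C0), (C1, Cw)), (-1, (C0, C1), (C1, Ct)), (2, (C1, C1), (Cw, C0)),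
     (-1, (C0, C0), (Cw, Cw)), (2, (C1, C1), (Cw, Cw)), (-1, (Cw, Cw), (Ct, Ct)),
     (-1, (C0, C1), (C1, Cw)), (1, (C0, C1), (Cw, C0)),
     (-1, (C1, C0), (Ct, C1)), (2, (C1, C1), (Cw, Ct)), (-1, (C1, Cw), (Ct, Ct)),
     (-1, (C1, Cw), (Ct, C1)), (1, (Cw, Ct), (Ct, C1)),
     (-1, (C0, Cw), (Ct, Cw)), (1, (C0, Ct), (Ct, Ct)),
     (-1, (Cw, C0), (Cw, Ct)), (1, (Ct, C0), (Ct, Ct))]"

text \<open>The graph is the Cartesian product of two rhombi with one extra edge, the Moser edge
  \<open>tip\<close>. The bound is a finite check over 16 truth values.\<close>

lemma window_le_3:
  fixes f :: "corner \<Rightarrow> corner \<Rightarrow> bool"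
  assumes row: "\<And>r s s'. f r s \<Longrightarrow> f r s' \<Longrightarrow> \<not> corner_adj s s'"
    and col: "\<And>r r' s. f r s \<Longrightarrow> f r' s \<Longrightarrow> \<not> corner_adj r r'"
    and tip: "\<not> (f C0 Ct \<and> f Ct C0)"
  shows "(\<Sum>(c, (r, s), (r', s'))\<leftarrow>window. c * of_bool (f r s \<and> f r' s')) \<le> 3"
proof -
  have R: "f r C0 \<longrightarrow> \<not> f r C1 \<and> \<not> f r Cw" "f r C1 \<longrightarrow> \<not> f r Cw" "f r Ct \<longrightarrow> \<not> f r C1 \<and> \<not> f r Cw"
    and C: "f C0 r \<longrightarrow> \<not> f C1 r \<and> \<not> f Cw r" "f C1 r \<longrightarrow> \<not> f Cw r" "f Ct r \<longrightarrow> \<not> f C1 r \<and> \<not> f Cw r" for r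
    using row[of r] col[of _ r] unfolding corner_adj_def by blast+
  show ?thesis
    using R[of C0] R[of C1] R[of Cw] R[of Ct] C[of C0] C[of C1] C[of Cw] C[of Ct] tip
    by (simp add: window_def;
      (cases "f C1 C1"; simp); (cases "f Cw Cw"; simp?); (cases "f C1 Cw"; simp?);
      (cases "f Cw C1"; simp?); (cases "f C0 C0"; simp?); (cases "f Ct Ct"; simp?);
      (cases "f C0 Ct"; simp?); (cases "f Ct C0"; simp?); (cases "f C0 C1"; simp?);
      (cases "f C0 Cw"; simp?); (cases "f Ct C1"; simp?); (cases "f Ct Cw"; simp?);
      (cases "f C1 C0"; simp?); (cases "f Cw C0"; simp?); (cases "f C1 Ct"; simp?);
      (cases "f Cw Ct"; simp?))
qed

section \<open>Embedding the window in the plane\<close>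

definition \<omega> :: complex where "\<omega> = Complex (1 / 2) (sqrt 3 / 2)"

lemma omega_square: "\<omega>\<^sup>2 = \<omega> - 1"
  by (simp add: \<omega>_def power2_eq_square complex_eq_iff)

lemma omega_mult_omega: "\<omega> * \<omega> = \<omega> - 1"
  using omega_square by (simp add: power2_eq_square)

lemma omega_mult_omega_mult: "\<omega> * (\<omega> * z) = \<omega> * z - z"
  by (metis omega_mult_omega mult.assoc left_diff_distrib mult_1)

lemma omega_pow_3: "\<omega> ^ 3 = -1"
  by (simp add: numeral_3_eq_3 omega_mult_omega algebra_simps)

lemma omega_pow_6: "\<omega> ^ 6 = 1"
  using power_mult[of \<omega> 3 2] by (simp add: omega_pow_3)

lemma norm_omega: "cmod \<omega> = 1"
  by (simp add: \<omega>_def cmod_def power_divide)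

lemma norm_omega_minus_1: "cmod (\<omega> - 1) = 1"
  by (simp add: omega_square[symmetric] norm_power norm_omega)

text \<open>The angle of the Moser spindle: rotating by \<^term>\<open>\<theta>\<close> moves the point \<^term>\<open>1 + \<omega>\<close>, which has
  modulus \<^term>\<open>sqrt 3\<close>, by distance 1.\<close>

definition \<theta> :: complex where "\<theta> = Complex (5 / 6) (sqrt 11 / 6)"

lemma norm_theta: "cmod \<theta> = 1"
  by (simp add: \<theta>_def cmod_def power_divide)

lemma norm_tips: "cmod ((1 + \<omega>) * (\<theta> - 1)) = 1"
proof -
  have "cmod (1 + \<omega>) = sqrt 3" "cmod (\<theta> - 1) = 1 / sqrt 3"
    by (simp_all add: \<theta>_def \<omega>_def cmod_def power_divide real_sqrt_divide power2_eq_square)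
  then show ?thesis by (simp add: norm_mult)
qed

text \<open>Summing over the six rotations makes pairs whose differences agree up to a power of
  \<open>\<omega>\<close> interchangeable in the mean.\<close>

definition orbit_sum :: "(complex \<Rightarrow> complex \<Rightarrow> real) \<Rightarrow> complex \<Rightarrow> complex \<Rightarrow> complex \<Rightarrow> real" where
  "orbit_sum q u v x = (\<Sum>k<6. q (x + \<omega> ^ k * u) (x + \<omega> ^ k * v))"

text \<open>The exponents shift cyclically because \<open>\<omega> ^ 6 = 1\<close>.\<close>

lemma orbit_sum_rotate: "orbit_sum q 0 (\<omega> * d) x = orbit_sum q 0 d x"
proof -
  have "orbit_sum q 0 (\<omega> * d) x = (\<Sum>k<6. q x (x + \<omega> ^ Suc k * d))"
    by (simp add: orbit_sum_def mult_ac)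
  also have "\<dots> = (\<Sum>k<6. q x (x + \<omega> ^ k * d))"
    using sum.lessThan_Suc_shift[of "\<lambda>k. q x (x + \<omega> ^ k * d)" 6]
      sum.lessThan_Suc[of "\<lambda>k. q x (x + \<omega> ^ k * d)" 6]
    by (simp add: omega_pow_6)
  finally show ?thesis by (simp add: orbit_sum_def)
qed

text \<open>For each \<open>k\<close>, translating \<open>x\<close> by
  \<open>\<omega> ^ k * u\<close> carries the pair based at \<open>x\<close> to the rotated pair of
  \<open>u\<close> and \<open>v\<close>.\<close>

lemma coboundary_orbit_sum:
  assumes "\<And>x y. \<bar>q x y\<bar> \<le> B"
  shows "coboundary (\<lambda>x. orbit_sum q u v x - orbit_sum q 0 (v - u) x)"
proof -
  have "coboundary (\<lambda>x. \<Sum>k<6. q (x + \<omega> ^ k * u) ((x + \<omega> ^ k * u) + \<omega> ^ k * (v - u))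
      - q x (x + \<omega> ^ k * (v - u)))"
    by (intro coboundary_sum coboundary_diff[where B = B] assms) simp
  then show ?thesis
    by (simp add: orbit_sum_def sum_subtractf algebra_simps)
qed

lemma orbit_sum_rotate_power: "orbit_sum q 0 (\<omega> ^ j * d) x = orbit_sum q 0 d x"
  by (induction j) (simp_all add: orbit_sum_rotate mult.assoc)

fun corner_pt :: "corner \<Rightarrow> complex" where
  "corner_pt C0 = 0"
| "corner_pt C1 = 1"
| "corner_pt Cw = \<omega>"
| "corner_pt Ct = 1 + \<omega>"

lemma norm_corner_adj:
  assumes "corner_adj r s"
  shows "cmod (corner_pt r - corner_pt s) = 1"
  using assms norm_omega norm_omega_minus_1 norm_minus_commute[of \<omega> 1]
  by (cases r; cases s) (auto simp: corner_adj_def)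

definition window_pt :: "corner \<times> corner \<Rightarrow> complex" where
  "window_pt = (\<lambda>(r, s). corner_pt r + \<theta> * corner_pt s)"

text \<open>These identities exhibit one representative for each of the seven classes of
  \<open>window\<close>; all follow from \<open>\<omega> * \<omega> = \<omega> - 1\<close>.\<close>

lemma window_rotation_classes:
  "window_pt (C1, Cw) - window_pt (C0, C0) = 1 + \<theta> * \<omega>"
  "window_pt (C1, Ct) - window_pt (C0, C1) = 1 + \<theta> * \<omega>"
  "window_pt (Cw, C0) - window_pt (C1, C1) = \<omega> ^ 2 * (1 + \<theta> * \<omega>)"
  "window_pt (Cw, Cw) - window_pt (C0, C0) = \<omega> * (1 + \<theta>)"
  "window_pt (Cw, Cw) - window_pt (C1, C1) = \<omega> ^ 2 * (1 + \<theta>)"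
  "window_pt (Ct, Ct) - window_pt (Cw, Cw) = 1 + \<theta>"
  "window_pt (C1, Cw) - window_pt (C0, C1) = 1 + \<theta> * (\<omega> - 1)"
  "window_pt (Cw, C0) - window_pt (C0, C1) = \<omega> * (1 + \<theta> * (\<omega> - 1))"
  "window_pt (Ct, C1) - window_pt (C1, C0) = \<omega> + \<theta>"
  "window_pt (Cw, Ct) - window_pt (C1, C1) = \<omega> * (\<omega> + \<theta>)"
  "window_pt (Ct, Ct) - window_pt (C1, Cw) = \<omega> + \<theta>"
  "window_pt (Ct, C1) - window_pt (C1, Cw) = \<omega> * (1 - \<theta> * \<omega>)"
  "window_pt (Ct, C1) - window_pt (Cw, Ct) = 1 - \<theta> * \<omega>"
  "window_pt (Ct, Cw) - window_pt (C0, Cw) = 1 + \<omega>"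
  "window_pt (Ct, Ct) - window_pt (C0, Ct) = 1 + \<omega>"
  "window_pt (Cw, Ct) - window_pt (Cw, C0) = \<theta> * (1 + \<omega>)"
  "window_pt (Ct, Ct) - window_pt (Ct, C0) = \<theta> * (1 + \<omega>)"
  by (simp_all add: window_pt_def algebra_simps power2_eq_square omega_mult_omega omega_mult_omega_mult)

text \<open>Each mixed class collapses to a single orbit sum with total coefficient 0, so only the
  diagonal entries survive.\<close>

lemma window_orbit_sum:
  "(\<Sum>(c, P, Q)\<leftarrow>window. c * orbit_sum q 0 (window_pt Q - window_pt P) x) = 11 * orbit_sum q 0 0 x"
  by (simp add: window_def window_rotation_classes orbit_sum_rotate orbit_sum_rotate_power)

lemma window_independent:
  assumes S: "\<And>y z. y \<in> S \<Longrightarrow> z \<in> S \<Longrightarrow> cmod (y - z) \<noteq> 1" and u: "cmod u = 1"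
  shows "(\<Sum>(c, P, Q)\<leftarrow>window. c * of_bool (x + u * window_pt P \<in> S \<and> x + u * window_pt Q \<in> S)) \<le> 3"
proof -
  define f where "f = (\<lambda>r s. x + u * window_pt (r, s) \<in> S)"
  have sep: "cmod (window_pt P - window_pt Q) \<noteq> 1"
    if "x + u * window_pt P \<in> S" "x + u * window_pt Q \<in> S" for P Q
  proof -
    have "x + u * window_pt P - (x + u * window_pt Q) = u * (window_pt P - window_pt Q)"
      by (simp add: algebra_simps)
    then show ?thesis using S[OF that] u by (simp add: norm_mult)
  qed
  have "(\<Sum>(c, (r, s), (r', s'))\<leftarrow>window. c * of_bool (f r s \<and> f r' s')) \<le> 3"
  proof (rule window_le_3)
    fix r s s' assume "f r s" "f r s'"
    moreover have "window_pt (r, s) - window_pt (r, s') = \<theta> * (corner_pt s - corner_pt s')"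
      by (simp add: window_pt_def algebra_simps)
    ultimately show "\<not> corner_adj s s'"
      using sep[of "(r, s)" "(r, s')"] norm_corner_adj[of s s'] by (auto simp: f_def norm_mult norm_theta)
  next
    fix r r' s assume "f r s" "f r' s"
    moreover have "window_pt (r, s) - window_pt (r', s) = corner_pt r - corner_pt r'"
      by (simp add: window_pt_def algebra_simps)
    ultimately show "\<not> corner_adj r r'"
      using sep[of "(r, s)" "(r', s)"] norm_corner_adj[of r r'] by (auto simp: f_def)
  next
    have "window_pt (C0, Ct) - window_pt (Ct, C0) = (1 + \<omega>) * (\<theta> - 1)"
      by (simp add: window_pt_def algebra_simps)
    then show "\<not> (f C0 Ct \<and> f Ct C0)"
      using sep[of "(C0, Ct)" "(Ct, C0)"] norm_tips by (auto simp: f_def)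
  qed
  then show ?thesis by (simp add: f_def case_prod_unfold)
qed

section \<open>Averaging over weighted families of independent sets\<close>

lemma sum_list_sum_swap:
  fixes f :: "'a \<Rightarrow> 'b \<Rightarrow> real"
  shows "(\<Sum>x\<leftarrow>xs. \<Sum>k\<in>B. f x k) = (\<Sum>k\<in>B. \<Sum>x\<leftarrow>xs. f x k)"
  by (induction xs) (simp_all add: sum.distrib)

lemma has_sum_sum_list:
  fixes f :: "'i \<Rightarrow> 'a \<Rightarrow> real"
  assumes "\<And>i. i \<in> set xs \<Longrightarrow> (f i has_sum s i) A"
  shows "((\<lambda>x. \<Sum>i\<leftarrow>xs. f i x) has_sum (\<Sum>i\<leftarrow>xs. s i)) A"
  using assms by (induction xs) (auto intro: has_sum_add)

lemma unit_distance_covering_weight: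
  fixes w :: "'i \<Rightarrow> real" and A :: "'i \<Rightarrow> complex set"
  assumes nonneg: "\<And>i. i \<in> I \<Longrightarrow> 0 \<le> w i" and T: "(w has_sum T) I"
    and indep: "\<And>i y z. i \<in> I \<Longrightarrow> y \<in> A i \<Longrightarrow> z \<in> A i \<Longrightarrow> cmod (y - z) \<noteq> 1"
    and cover: "\<And>x. 1 \<le> infsum w {i \<in> I. x \<in> A i}"
  shows "11 / 3 \<le> T"
proof -
  define q where "q x y = infsum w {i \<in> I. x \<in> A i \<and> y \<in> A i}" for x y
  have q: "((\<lambda>i. w i * of_bool (x \<in> A i \<and> y \<in> A i)) has_sum q x y) I" for x y
  proof -
    have "w summable_on I" using T by (rule has_sum_imp_summable)
    then have "w summable_on {i \<in> I. x \<in> A i \<and> y \<in> A i}"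
      by (rule summable_on_subset_banach) simp
    then have "(w has_sum q x y) {i \<in> I. x \<in> A i \<and> y \<in> A i}"
      unfolding q_def by (rule has_sum_infsum)
    moreover have "(w has_sum q x y) {i \<in> I. x \<in> A i \<and> y \<in> A i} \<longleftrightarrow>
        ((\<lambda>i. w i * of_bool (x \<in> A i \<and> y \<in> A i)) has_sum q x y) I"
      by (rule has_sum_cong_neutral) auto
    ultimately show ?thesis by simp
  qed
  \<comment> \<open>This uniform bound makes translation differences of \<open>q\<close> admissible
    in \<open>coboundary\<close>.\<close>
  have q_bound: "\<bar>q x y\<bar> \<le> T" for x y
  proof -
    have "0 \<le> q x y" using q by (rule has_sum_nonneg) (use nonneg in auto)
    moreover have "q x y \<le> T" using q T by (rule has_sum_mono) (use nonneg in auto)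
    ultimately show ?thesis by simp
  qed
  have local: "(\<Sum>(c, P, Q)\<leftarrow>window. c * q (x + u * window_pt P) (x + u * window_pt Q)) \<le> 3 * T"
    if "cmod u = 1" for x u
  proof -
    let ?b = "\<lambda>i (P, Q). of_bool (x + u * window_pt P \<in> A i \<and> x + u * window_pt Q \<in> A i) :: real"
    have "((\<lambda>i. \<Sum>(c, P, Q)\<leftarrow>window. c * (w i * ?b i (P, Q))) has_sum
        (\<Sum>(c, P, Q)\<leftarrow>window. c * q (x + u * window_pt P) (x + u * window_pt Q))) I"
      unfolding case_prod_unfold by (intro has_sum_sum_list has_sum_cmult_right) (use q in simp)
    moreover have "((\<lambda>i. 3 * w i) has_sum 3 * T) I"
      by (intro has_sum_cmult_right T)
    ultimately show ?thesis
    proof (rule has_sum_mono)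
      fix i assume "i \<in> I"
      have "(\<Sum>(c, P, Q)\<leftarrow>window. c * (w i * ?b i (P, Q))) = w i * (\<Sum>(c, P, Q)\<leftarrow>window. c * ?b i (P, Q))"
        by (simp add: sum_list_const_mult[symmetric] case_prod_unfold mult.left_commute)
      also have "\<dots> \<le> w i * 3"
        using window_independent[OF indep that] \<open>i \<in> I\<close> nonneg
        by (intro mult_left_mono) auto
      finally show "(\<Sum>(c, P, Q)\<leftarrow>window. c * (w i * ?b i (P, Q))) \<le> 3 * w i"
        by (simp add: mult.commute)
    qed
  qed
  \<comment> \<open>The error made by moving the first point of every window pair to
    \<open>x\<close>.\<close>
  define D where "D x = (\<Sum>(c, P, Q)\<leftarrow>window. c * (orbit_sum q (window_pt P) (window_pt Q) x
    - orbit_sum q 0 (window_pt Q - window_pt P) x))" for x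
  have "coboundary D"
    unfolding D_def case_prod_unfold
    by (intro coboundary_sum_list coboundary_cmult coboundary_orbit_sum[OF q_bound])
  \<comment> \<open>Six rotations turn the constants 11 and 3 into 66 and 18.\<close>
  moreover have "66 - 18 * T \<le> (-1) * D x" for x
  proof -
    have "(\<Sum>(c, P, Q)\<leftarrow>window. c * orbit_sum q (window_pt P) (window_pt Q) x)
      = (\<Sum>k<6. \<Sum>(c, P, Q)\<leftarrow>window. c * q (x + \<omega> ^ k * window_pt P) (x + \<omega> ^ k * window_pt Q))"
      by (simp add: orbit_sum_def sum_distrib_left sum_list_sum_swap[symmetric] case_prod_unfold)
    also have "\<dots> \<le> (\<Sum>k<6::nat. 3 * T)"
      by (intro sum_mono local) (simp add: norm_power norm_omega)
    finally have upper: "(\<Sum>(c, P, Q)\<leftarrow>window. c * orbit_sum q (window_pt P) (window_pt Q) x) \<le> 18 * T"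
      by simp
    have "(\<Sum>k<6::nat. 1) \<le> (\<Sum>k<6::nat. q x x)"
      using cover[of x] by (intro sum_mono) (simp add: q_def)
    then have "6 \<le> orbit_sum q 0 0 x"
      by (simp add: orbit_sum_def)
    moreover have "D x = (\<Sum>(c, P, Q)\<leftarrow>window. c * orbit_sum q (window_pt P) (window_pt Q) x)
        - 11 * orbit_sum q 0 0 x"
      unfolding window_orbit_sum[symmetric] D_def
      by (simp add: case_prod_unfold right_diff_distrib sum_list_subtractf)
    ultimately show ?thesis using upper by simp
  qed
  ultimately have "66 - 18 * T \<le> 0"
    by (rule coboundary_lower_bound[OF coboundary_cmult])
  then show ?thesis by simp
qed

section \<open>Colorings of the plane\<close>

definition plane_pt :: "complex \<Rightarrow> real ^ 2" where
  "plane_pt z = vector [Re z, Im z]"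

lemma dist_plane_pt: "dist (plane_pt y) (plane_pt z) = cmod (y - z)"
  by (simp add: plane_pt_def dist_vec_def L2_set_def UNIV_2 cmod_def dist_real_def)

text \<open>A finite \<open>ennreal\<close> sum bounds all finite partial sums, which yields
  summability over the reals.\<close>

lemma ennreal_infsum:
  fixes f :: "'a \<Rightarrow> real"
  assumes nonneg: "\<And>x. x \<in> A \<Longrightarrow> 0 \<le> f x" and fin: "(\<Sum>\<^sub>\<infinity>x\<in>A. ennreal (f x)) \<noteq> \<infinity>"
  shows "f summable_on A" "(\<Sum>\<^sub>\<infinity>x\<in>A. ennreal (f x)) = ennreal (infsum f A)"
proof -
  have sums: "(\<Sum>x\<in>F. ennreal (f x)) = ennreal (sum f F)" if "F \<subseteq> A" for F
    using that nonneg by (intro sum_ennreal) auto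
  obtain B where B: "0 \<le> B" "(\<Sum>\<^sub>\<infinity>x\<in>A. ennreal (f x)) = ennreal B"
    using fin by (cases "\<Sum>\<^sub>\<infinity>x\<in>A. ennreal (f x)") auto
  have "sum f F \<le> B" if "finite F" "F \<subseteq> A" for F
  proof -
    have "ennreal (sum f F) \<le> ennreal B"
      unfolding B(2)[symmetric] sums[OF that(2), symmetric]
      using that by (auto simp: nonneg_infsum_complete intro!: SUP_upper)
    then show ?thesis using B(1) by simp
  qed
  then show "f summable_on A"
    using nonneg
    by (intro nonneg_bounded_partial_sums_imp_summable_on[where C = B]
      eventually_finite_subsets_at_top_weakI) auto
  then show "(\<Sum>\<^sub>\<infinity>x\<in>A. ennreal (f x)) = ennreal (infsum f A)"
    using nonneg sums
    by (subst infsum_nonneg_is_SUPREMUM_ennreal)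
      (auto simp: nonneg_infsum_complete intro!: SUP_cong)
qed

theorem fractional_chromatic_number_plane_ge:
  "fractional_chromatic_number (UNIV :: (real ^ 2) set) unit_distance \<ge> ennreal (11 / 3)"
  unfolding fractional_chromatic_number_def
proof (rule INF_greatest)
  fix w :: "(real ^ 2) set \<Rightarrow> real"
  assume "w \<in> {w. fractional_coloring UNIV unit_distance w}"
  then have nonneg: "0 \<le> w S"
    and cover: "1 \<le> (\<Sum>\<^sub>\<infinity>S\<in>{S. independent_set UNIV unit_distance S \<and> v \<in> S}. ennreal (w S))" for S v
    by (auto simp: fractional_coloring_def)
  define I where "I = {S. independent_set (UNIV :: (real ^ 2) set) unit_distance S}"
  have total: "total_weight UNIV unit_distance w = (\<Sum>\<^sub>\<infinity>S\<in>I. ennreal (w S))"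
    by (simp add: total_weight_def I_def)
  show "ennreal (11 / 3) \<le> total_weight UNIV unit_distance w"
  proof (cases "(\<Sum>\<^sub>\<infinity>S\<in>I. ennreal (w S)) = \<infinity>")
    case True
    then show ?thesis by (simp add: total)
  next
    case False
    note sum = ennreal_infsum[OF nonneg False]
    have "11 / 3 \<le> infsum w I"
    proof (rule unit_distance_covering_weight[where A = "\<lambda>S. plane_pt -` S"])
      show "(w has_sum infsum w I) I"
        using sum(1) by (rule has_sum_infsum)
      show "cmod (y - z) \<noteq> 1" if "S \<in> I" "y \<in> plane_pt -` S" "z \<in> plane_pt -` S" for S y z
        using that by (auto simp: I_def independent_set_def unit_distance_def dist_plane_pt[symmetric])
      show "1 \<le> infsum w {S \<in> I. x \<in> plane_pt -` S}" for x
      proof -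
        let ?J = "{S \<in> I. x \<in> plane_pt -` S}"
        have J: "?J = {S. independent_set UNIV unit_distance S \<and> plane_pt x \<in> S}"
          by (auto simp: I_def)
        \<comment> \<open>The covering sum is finite because the total weight is, so it can be read
          as a real sum.\<close>
        have "(\<Sum>\<^sub>\<infinity>S\<in>?J. ennreal (w S)) \<le> (\<Sum>\<^sub>\<infinity>S\<in>I. ennreal (w S))"
          by (rule infsum_mono_neutral) (auto intro: nonneg_summable_on_complete)
        with False have "(\<Sum>\<^sub>\<infinity>S\<in>?J. ennreal (w S)) \<noteq> \<infinity>"
          by (auto simp: top_unique)
        then have "(\<Sum>\<^sub>\<infinity>S\<in>?J. ennreal (w S)) = ennreal (infsum w ?J)"
          by (intro ennreal_infsum(2) nonneg)
        then have "1 \<le> ennreal (infsum w ?J)"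
          using cover[of "plane_pt x"] unfolding J by simp
        then show ?thesis by simp
      qed
    qed (rule nonneg)
    then have "ennreal (11 / 3) \<le> ennreal (infsum w I)"
      by (rule ennreal_leI)
    then show ?thesis by (simp add: total sum(2))
  qed
qed

theorem mainTheorem1:
  shows "fractional_chromatic_number (UNIV :: (real ^ 2) set) unit_distance \<ge> ennreal (76 / 21)"
proof -
  \<comment> \<open>Here \<open>11 / 3\<close> equals \<open>77 / 21\<close>.\<close>
  have "ennreal (76 / 21) \<le> ennreal (11 / 3)"
    by (rule ennreal_leI) simp
  also note fractional_chromatic_number_plane_ge
  finally show ?thesis .
qed

end
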